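(* Let $\mathbf{V}$ be a finite set of continuous real-valued random variables whose joint distribution $\mathbf{P}$ is faithful to a directed acyclic graph $\mathcal{G}$ with vertex set $\mathbf{V}$ (causal sufficiency: $\mathcal{G}$ has no vertices outside $\mathbf{V}$). Let $T\in\mathbf{V}$ and let $\mathcal{MB}_T\subseteq\mathbf{V}\setminus\{T\}$ be its Markov boundary. Then $\mathcal{MB}_T$ is the unique minimal (with respect to inclusion) subset among the subsets $\mathbf{S}\subseteq\mathbf{V}\setminus\{T\}$ that minimize the conditional entropy $H(T\mid\mathbf{S})$ over all subsets of $\mathbf{V}\setminus\{T\}$. Furthermore, for every $\mathbf{S}'\subseteq\mathbf{V}\setminus\{T\}$ with $\mathcal{MB}_T\subseteq\mathbf{S}'$, $$H(T\mid\mathbf{S}')=H(T\mid\mathcal{MB}_T).$$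
   Context: Faithfulness of $\mathbf{P}$ and $\mathcal{G}$ to each other means: for all pairwise disjoint $\mathbf{A},\mathbf{B},\mathbf{C}\subseteq\mathbf{V}$, $\mathbf{A}$ and $\mathbf{B}$ are conditionally independent given $\mathbf{C}$ under $\mathbf{P}$ if and only if $\mathbf{A}$ and $\mathbf{B}$ are d-separated by $\mathbf{C}$ in $\mathcal{G}$. The Markov boundary of $X\in\mathbf{V}$ is $\mathcal{MB}_X=Pa_X\cup Ch_X\cup Sp_X$, where $Pa_X$ is the set of parents of $X$ in $\mathcal{G}$, $Ch_X$ the set of children of $X$, and $Sp_X$ the set of spouses (co-parents) of $X$, i.e. the variables other than $X$ that are parents of some child of $X$. For a set $\mathbf{S}$ of variables, $H(\mathbf{S})=-\mathbb{E}[\log p(\mathbf{x}_{\mathbf{S}})]$ is the (differential) entropy of its joint density, with $H(\emptyset)=0$, and $H(T\mid\mathbf{S})=H(\{T\}\cup\mathbf{S})-H(\mathbf{S})$. It is assumed that $\mathbf{P}$ has a joint density and that all these entropies are finite. *)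

theory Defs
  imports "HOL-Probability.Probability"
begin

definition dag :: "'v set \<Rightarrow> ('v \<times> 'v) set \<Rightarrow> bool" where
  "dag V E \<longleftrightarrow> finite V \<and> E \<subseteq> V \<times> V \<and> acyclic E"

definition parents :: "('v \<times> 'v) set \<Rightarrow> 'v \<Rightarrow> 'v set" where
  "parents E x = {y. (y, x) \<in> E}"

definition children :: "('v \<times> 'v) set \<Rightarrow> 'v \<Rightarrow> 'v set" where
  "children E x = {y. (x, y) \<in> E}"

definition spouses :: "('v \<times> 'v) set \<Rightarrow> 'v \<Rightarrow> 'v set" where
  "spouses E x = {y. y \<noteq> x \<and> (\<exists>c \<in> children E x. y \<in> parents E c)}"

definition markov_boundary :: "('v \<times> 'v) set \<Rightarrow> 'v \<Rightarrow> 'v set" where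
  "markov_boundary E x = parents E x \<union> children E x \<union> spouses E x"

definition undirected_path :: "('v \<times> 'v) set \<Rightarrow> 'v list \<Rightarrow> bool" where
  "undirected_path E p \<longleftrightarrow> p \<noteq> [] \<and> distinct p \<and>
     (\<forall>i. Suc i < length p \<longrightarrow> (p ! i, p ! Suc i) \<in> E \<or> (p ! Suc i, p ! i) \<in> E)"

text \<open>For an inner position \<open>i\<close> of the path, i.e. \<open>0 < i\<close> and \<open>Suc i < length p\<close>.\<close>

definition collider :: "('v \<times> 'v) set \<Rightarrow> 'v list \<Rightarrow> nat \<Rightarrow> bool" where
  "collider E p i \<longleftrightarrow> (p ! (i - 1), p ! i) \<in> E \<and> (p ! Suc i, p ! i) \<in> E"

text \<open>A path is blocked by \<open>C\<close> if it has an inner non-collider in \<open>C\<close>, or a collider such that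
  neither it nor any of its descendants (jointly \<open>E\<^sup>* `` {p ! i}\<close>) is in \<open>C\<close>.\<close>

definition blocked :: "('v \<times> 'v) set \<Rightarrow> 'v set \<Rightarrow> 'v list \<Rightarrow> bool" where
  "blocked E C p \<longleftrightarrow> (\<exists>i. 0 < i \<and> Suc i < length p \<and>
     (if collider E p i then E\<^sup>* `` {p ! i} \<inter> C = {} else p ! i \<in> C))"

definition d_separated :: "('v \<times> 'v) set \<Rightarrow> 'v set \<Rightarrow> 'v set \<Rightarrow> 'v set \<Rightarrow> bool" where
  "d_separated E A B C \<longleftrightarrow>
     (\<forall>p. undirected_path E p \<and> hd p \<in> A \<and> last p \<in> B \<longrightarrow> blocked E C p)"

definition subvector :: "('v \<Rightarrow> 'a \<Rightarrow> real) \<Rightarrow> 'v set \<Rightarrow> 'a \<Rightarrow> 'v \<Rightarrow> real" where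
  "subvector X S = (\<lambda>\<omega>. \<lambda>i\<in>S. X i \<omega>)"

definition generated_algebra :: "'a measure \<Rightarrow> ('v \<Rightarrow> 'a \<Rightarrow> real) \<Rightarrow> 'v set \<Rightarrow> 'a measure" where
  "generated_algebra M X S =
     vimage_algebra (space M) (subvector X S) (Pi\<^sub>M S (\<lambda>_. borel))"

text \<open>\<open>P(F \<inter> G | X\<^sub>C) = P(F | X\<^sub>C) P(G | X\<^sub>C)\<close> almost surely, for all events \<open>F\<close> generated by
  \<open>X\<^sub>A\<close> and \<open>G\<close> generated by \<open>X\<^sub>B\<close>.\<close>

definition cond_indep ::
  "'a measure \<Rightarrow> ('v \<Rightarrow> 'a \<Rightarrow> real) \<Rightarrow> 'v set \<Rightarrow> 'v set \<Rightarrow> 'v set \<Rightarrow> bool" where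
  "cond_indep M X A B C \<longleftrightarrow>
     (\<forall>F \<in> sets (generated_algebra M X A). \<forall>G \<in> sets (generated_algebra M X B).
        AE \<omega> in M.
          real_cond_exp M (generated_algebra M X C) (indicator (F \<inter> G)) \<omega> =
          real_cond_exp M (generated_algebra M X C) (indicator F) \<omega> *
          real_cond_exp M (generated_algebra M X C) (indicator G) \<omega>)"

definition faithful ::
  "'a measure \<Rightarrow> ('v \<Rightarrow> 'a \<Rightarrow> real) \<Rightarrow> 'v set \<Rightarrow> ('v \<times> 'v) set \<Rightarrow> bool" where
  "faithful M X V E \<longleftrightarrow>
     (\<forall>A B C. A \<subseteq> V \<and> B \<subseteq> V \<and> C \<subseteq> V \<and> A \<inter> B = {} \<and> A \<inter> C = {} \<and> B \<inter> C = {} \<longrightarrow>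
        (cond_indep M X A B C \<longleftrightarrow> d_separated E A B C))"

text \<open>Logarithms are to the base \<open>b\<close>.\<close>

definition has_finite_entropy ::
  "'a measure \<Rightarrow> real \<Rightarrow> ('v \<Rightarrow> 'a \<Rightarrow> real) \<Rightarrow> 'v set \<Rightarrow> bool" where
  "has_finite_entropy M b X S \<longleftrightarrow>
     (\<exists>p. information_space.finite_entropy M b (Pi\<^sub>M S (\<lambda>_. lborel)) (subvector X S) p)"

definition diff_entropy ::
  "'a measure \<Rightarrow> real \<Rightarrow> ('v \<Rightarrow> 'a \<Rightarrow> real) \<Rightarrow> 'v set \<Rightarrow> real" where
  "diff_entropy M b X S = prob_space.entropy M b (Pi\<^sub>M S (\<lambda>_. lborel)) (subvector X S)"

definition cond_diff_entropy ::
  "'a measure \<Rightarrow> real \<Rightarrow> ('v \<Rightarrow> 'a \<Rightarrow> real) \<Rightarrow> 'v \<Rightarrow> 'v set \<Rightarrow> real" where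
  "cond_diff_entropy M b X T S = diff_entropy M b X (insert T S) - diff_entropy M b X S"

text \<open>No convention is needed for the empty set: \<open>\<real>\<^sup>\<emptyset>\<close> is a one-point probability space.\<close>

lemma (in information_space) diff_entropy_empty:
  fixes X :: "'v \<Rightarrow> 'a \<Rightarrow> real"
  shows "diff_entropy M b X {} = 0"
proof -
  let ?N = "Pi\<^sub>M {} (\<lambda>_. lborel) :: ('v \<Rightarrow> real) measure"
  have N: "?N = count_space {\<lambda>_. undefined}"
    by (rule PiM_empty)
  have m: "subvector X {} \<in> measurable M ?N"
    unfolding N by (simp add: subvector_def restrict_def)
  have "distr M ?N (subvector X {}) = density ?N (\<lambda>_. ennreal 1)"
  proof (rule measure_eqI_finite[of _ "{\<lambda>_. undefined}"])
    fix a :: "'v \<Rightarrow> real" assume "a \<in> {\<lambda>_. undefined}"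
    then have a: "a = (\<lambda>_. undefined)" by simp
    have "emeasure (distr M ?N (subvector X {})) {a} = emeasure M (subvector X {} -` {a} \<inter> space M)"
      using m by (intro emeasure_distr) (auto simp: N a)
    also have "subvector X {} -` {a} \<inter> space M = space M"
      by (auto simp: a subvector_def)
    finally show "emeasure (distr M ?N (subvector X {})) {a} =
        emeasure (density ?N (\<lambda>_. ennreal 1)) {a}"
      by (simp add: N a emeasure_space_1 emeasure_density)
  qed (auto simp: N)
  then have "distributed M ?N (subvector X {}) (\<lambda>_. ennreal 1)"
    using m by (auto simp: distributed_def)
  then have "entropy b ?N (subvector X {}) = - (\<integral>x. 1 * log b 1 \<partial>?N)"
    by (intro entropy_distr) auto
  then show ?thesis
    by (simp add: diff_entropy_def)
qed

end

(* For disjoint I, J, K the number H(I K) + H(J K) - H(I J K) - H(K) is the Kullback-Leibler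
   divergence of the law of (X_I, X_J, X_K) from the law with density p_IK p_JK / p_K. The two laws
   agree on rectangles iff X_I and X_J are conditionally independent given X_K; hence the number is
   nonnegative and vanishes exactly in that case. So H(T | S) decreases as S grows, and for S <= R,
   H(T | R) = H(T | S) iff T is independent of R - S given S, which by faithfulness is
   d-separation. The Markov boundary d-separates T from everything else, and every set that
   d-separates T from all remaining vertices contains it: an adjacent vertex y is
   reached by the path T, y and a spouse y by T, c, y with the collider c. *)
theory Submission
  imports Defs
begin

section \<open>The Markov boundary and d-separation\<close>

text \<open>Two gaps lie between the definitions and this argument. Conditional independence speaks
  of conditional expectations given generated sigma-algebras, entropy of densities. They meet in the
  formula P(X in A | Z = z) = (integral of p_XZ(x, z) over x in A) / p_Z(z), where points with
  p_Z(z) = 0 need care. Moreover, the entropy of a set of variables refers to Lebesgue measure on a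
  single product indexed by that set, whereas the divergence needs separate factors for I, J and K.
  Regrouping coordinates preserves Lebesgue measure, so entropies do not change. Finiteness of the
  entropies lets the integral of the logarithmic ratio split into four. Both directions of
  faithfulness enter: from d-separation to independence to see that every superset of the boundary
  is a minimizer, and from independence to d-separation to see that every minimizer contains the
  boundary.\<close>

lemma adjacent_markov_boundary:
  "(x, y) \<in> E \<or> (y, x) \<in> E \<Longrightarrow> y \<in> markov_boundary E x"
  by (auto simp: markov_boundary_def parents_def children_def)

lemma coparent_markov_boundary:
  "(x, c) \<in> E \<Longrightarrow> (y, c) \<in> E \<Longrightarrow> y \<noteq> x \<Longrightarrow> y \<in> markov_boundary E x"
  by (auto simp: markov_boundary_def spouses_def parents_def children_def)

lemma markov_boundary_subset:
  assumes "dag V E"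
  shows "markov_boundary E x \<subseteq> V - {x}"
proof -
  have "(z, z) \<notin> E" for z
    using assms by (auto simp: dag_def acyclic_def)
  then show ?thesis
    using assms by (auto simp: dag_def markov_boundary_def spouses_def parents_def children_def)
qed

text \<open>A path from \<open>x\<close> to \<open>B\<close> is blocked within two steps. Its second
  vertex is a neighbour of \<open>x\<close>, hence in the boundary, and blocks unless it is a
  collider. In that case the third vertex is a co-parent of \<open>x\<close>, again in the boundary,
  and it is no collider because its edge points back to the second vertex and there are no 2-cycles.
  Neither vertex can be the last one, since \<open>B\<close> avoids the boundary.\<close>

lemma markov_boundary_d_separated:
  assumes "dag V E" and B: "x \<notin> B" "B \<inter> markov_boundary E x = {}"
  shows "d_separated E {x} B (markov_boundary E x)"
  unfolding d_separated_def
proof (intro allI impI)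
  fix p assume "undirected_path E p \<and> hd p \<in> {x} \<and> last p \<in> B"
  then have ne: "p \<noteq> []" and dist: "distinct p" and p0: "p ! 0 = x" and
    lst: "p ! (length p - 1) \<in> B" and
    adj: "\<And>i. Suc i < length p \<Longrightarrow> (p ! i, p ! Suc i) \<in> E \<or> (p ! Suc i, p ! i) \<in> E"
    by (auto simp: undirected_path_def hd_conv_nth last_conv_nth)
  have asym: "(v, u) \<notin> E" if "(u, v) \<in> E" for u v
    using assms(1) that by (auto simp: dag_def acyclic_def dest: trancl.intros)
  have l1: "1 < length p"
    using ne p0 lst B(1) by (cases "length p = 1") (auto simp: Suc_lessI)
  have p1: "p ! 1 \<in> markov_boundary E x"
    using adj[of 0] l1 p0 by (intro adjacent_markov_boundary) auto
  then have l2: "2 < length p"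
    using l1 lst B(2) by (cases "length p = 2") auto
  show "blocked E (markov_boundary E x) p"
  proof (cases "collider E p 1")
    case False
    then show ?thesis
      using p1 l2 unfolding blocked_def by (intro exI[of _ 1]) auto
  next
    case True
    then have e: "(x, p ! 1) \<in> E" "(p ! 2, p ! 1) \<in> E"
      using p0 by (auto simp: collider_def numeral_2_eq_2)
    have "p ! 2 \<noteq> x"
      using dist l2 ne p0 nth_eq_iff_index_eq[of p 2 0] by auto
    then have p2: "p ! 2 \<in> markov_boundary E x"
      using e by (intro coparent_markov_boundary) auto
    then have l3: "3 < length p"
      using l2 lst B(2) by (cases "length p = 3") auto
    have "\<not> collider E p 2"
      using asym[OF e(2)] by (auto simp: collider_def)
    then show ?thesis
      using p2 l3 unfolding blocked_def by (intro exI[of _ 2]) auto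
  qed
qed

lemma d_separator_contains_markov_boundary:
  assumes "dag V E" and "x \<notin> S" and sep: "d_separated E {x} (V - {x} - S) S"
  shows "markov_boundary E x \<subseteq> S"
proof -
  have EV: "E \<subseteq> V \<times> V" and irr: "(z, z) \<notin> E" for z
    using assms(1) by (auto simp: dag_def acyclic_def)
  have adj: "y \<in> S" if "(x, y) \<in> E \<or> (y, x) \<in> E" for y
  proof (rule ccontr)
    assume "y \<notin> S"
    moreover have "undirected_path E [x, y]"
      using that irr by (auto simp: undirected_path_def less_Suc_eq)
    moreover have "y \<in> V" "y \<noteq> x"
      using that EV irr by auto
    ultimately have "blocked E S [x, y]"
      using sep by (simp add: d_separated_def)
    \<comment> \<open>A path of two vertices has no inner position at which it could be
      blocked.\<close>
    then show False
      by (simp add: blocked_def)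
  qed
  have "y \<in> S" if "y \<in> spouses E x" for y
  proof (rule ccontr)
    assume "y \<notin> S"
    from that obtain c where c: "y \<noteq> x" "(x, c) \<in> E" "(y, c) \<in> E"
      by (auto simp: spouses_def children_def parents_def)
    have "undirected_path E [x, c, y]"
      using c irr by (auto simp: undirected_path_def less_Suc_eq nth_Cons')
    moreover have "y \<in> V"
      using c EV by auto
    ultimately have "blocked E S [x, c, y]"
      using sep c(1) \<open>y \<notin> S\<close> by (simp add: d_separated_def)
    \<comment> \<open>The child \<open>c\<close> is covered by the adjacent case. It is the only
      inner vertex, and since \<open>E\<^sup>*\<close> is reflexive, a collider in \<open>S\<close>
      leaves the path open.\<close>
    moreover have "c \<in> S"
      using adj c by auto
    ultimately show False
      using c by (auto simp: blocked_def collider_def less_Suc_eq split: if_splits)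
  qed
  then show ?thesis
    using adj by (auto simp: markov_boundary_def parents_def children_def)
qed

section \<open>Conditional expectations and divergences\<close>

text \<open>Rectangles form an intersection-stable generator. The whole space is itself a rectangle
  of finite measure, so a constant sequence exhausts it.\<close>

lemma measure_eqI_pair_rectangles:
  assumes sets: "sets M = sets (S \<Otimes>\<^sub>M T)" "sets N = sets (S \<Otimes>\<^sub>M T)"
    and fin: "finite_measure M"
    and eq: "\<And>A B. A \<in> sets S \<Longrightarrow> B \<in> sets T \<Longrightarrow> emeasure M (A \<times> B) = emeasure N (A \<times> B)"
  shows "M = N"
proof (rule measure_eqI_generator_eq[OF Int_stable_pair_measure_generator[of S T],
      where \<Omega> = "space S \<times> space T" and A = "\<lambda>_. space S \<times> space T"])
  interpret finite_measure M by fact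
  show "emeasure M (space S \<times> space T) \<noteq> \<infinity>" for i :: nat
    by simp
qed (use sets.space_closed[of S] sets.space_closed[of T] eq
  in \<open>auto simp: sets sets_pair_measure\<close>)

lemma measure_eqI_triple_rectangles:
  assumes sets: "sets M = sets (S \<Otimes>\<^sub>M T \<Otimes>\<^sub>M P)" "sets N = sets (S \<Otimes>\<^sub>M T \<Otimes>\<^sub>M P)"
    and fin: "finite_measure M"
    and eq: "\<And>A B C. A \<in> sets S \<Longrightarrow> B \<in> sets T \<Longrightarrow> C \<in> sets P \<Longrightarrow>
      emeasure M (A \<times> B \<times> C) = emeasure N (A \<times> B \<times> C)"
  shows "M = N"
proof (rule measure_eqI_pair_rectangles[OF sets fin])
  interpret finite_measure M by fact
  fix A D assume A: "A \<in> sets S" and D: "D \<in> sets (T \<Otimes>\<^sub>M P)"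
  \<comment> \<open>For fixed \<open>A\<close>, mapping \<open>D\<close> to the measure of
    \<open>A \<times> D\<close> is again a measure, on the last two factors. The lemma for pairs,
    applied to these slices, extends agreement from \<open>B \<times> C\<close> to every measurable
    \<open>D\<close>; applied once more, it gives the claim.\<close>
  let ?slice = "\<lambda>L. distr (restrict_space L (A \<times> space (T \<Otimes>\<^sub>M P))) (T \<Otimes>\<^sub>M P) snd"
  have slice: "emeasure (?slice L) B = emeasure L (A \<times> B)"
    if L: "sets L = sets (S \<Otimes>\<^sub>M T \<Otimes>\<^sub>M P)" and B: "B \<in> sets (T \<Otimes>\<^sub>M P)" for L B
  proof -
    have m: "snd \<in> measurable (restrict_space L (A \<times> space (T \<Otimes>\<^sub>M P))) (T \<Otimes>\<^sub>M P)"
      using measurable_cong_sets[OF L refl, of "T \<Otimes>\<^sub>M P"] by (intro measurable_restrict_space1) auto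
    have A': "A \<times> space (T \<Otimes>\<^sub>M P) \<in> sets L"
      using A unfolding L by auto
    have "snd -` B \<inter> space (restrict_space L (A \<times> space (T \<Otimes>\<^sub>M P))) = A \<times> B"
      using sets.sets_into_space[OF B] sets.sets_into_space[OF A] sets_eq_imp_space_eq[OF L]
      by (auto simp: space_restrict_space space_pair_measure)
    with B A' show ?thesis
      using sets.sets_into_space[OF B]
      by (subst emeasure_distr[OF m]) (auto intro!: emeasure_restrict_space)
  qed
  have "?slice M = ?slice N"
  proof (rule measure_eqI_pair_rectangles)
    show "finite_measure (?slice M)"
      using slice[OF sets(1) sets.top] by (intro finite_measureI) simp
  qed (use A eq in \<open>auto simp: slice sets\<close>)
  then show "emeasure M (A \<times> D) = emeasure N (A \<times> D)"
    using slice[OF sets(1) D] slice[OF sets(2) D] by simp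
qed

text \<open>By absolute continuity, \<open>density M g\<close> has density \<open>g / f\<close>
  relative to the probability measure \<open>density M f\<close>. This reduces the claim to the
  equality case of Gibbs' inequality over a probability space.\<close>

lemma (in sigma_finite_measure) KL_density_density_eq_0_iff:
  fixes f g :: "'a \<Rightarrow> real"
  assumes "1 < b"
  assumes f: "f \<in> borel_measurable M" "AE x in M. 0 \<le> f x" "prob_space (density M f)"
  assumes g: "g \<in> borel_measurable M" "AE x in M. 0 \<le> g x" "prob_space (density M g)"
  assumes ac: "AE x in M. f x = 0 \<longrightarrow> g x = 0"
  assumes int: "integrable M (\<lambda>x. g x * log b (g x / f x))"
  shows "KL_divergence b (density M f) (density M g) = 0 \<longleftrightarrow> density M g = density M f"
proof -
  interpret Mf: prob_space "density M f" by fact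
  interpret Mf: information_space "density M f" b by standard fact
  have eq: "density (density M f) (\<lambda>x. g x / f x) = density M g" (is "?DD = _")
    using f g ac by (subst density_density_divide) simp_all
  have "KL_divergence b (density M f) ?DD = 0 \<longleftrightarrow> ?DD = density M f"
  proof (rule Mf.KL_eq_0_iff_eq)
    show "prob_space ?DD" unfolding eq by fact
    show "(\<lambda>x. g x / f x) \<in> borel_measurable (density M f)"
      using f g by auto
    show "AE x in density M f. 0 \<le> g x / f x"
      using f g by (auto simp: AE_density)
    show "integrable (density M f) (\<lambda>x. g x / f x * log b (g x / f x))"
      using \<open>1 < b\<close> f g ac
      by (subst integrable_density)
         (auto intro!: integrable_cong_AE[THEN iffD2, OF _ _ _ int] measurable_If)
  qed
  then show ?thesis
    by (simp add: eq)
qed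

text \<open>The characterization of conditional expectation by integrals over sets of
  \<open>F\<close>, phrased with nonnegative integrals so that Tonelli's theorem can evaluate them
  and integrability of \<open>g\<close> comes out as a consequence.\<close>

lemma (in finite_measure_subalgebra) real_cond_exp_indicator_eq_iff:
  fixes g :: "'a \<Rightarrow> real"
  assumes H[measurable]: "H \<in> sets M" and g[measurable]: "g \<in> borel_measurable F"
    and nonneg: "\<And>x. x \<in> space M \<Longrightarrow> 0 \<le> g x"
  shows "(AE x in M. real_cond_exp M F (indicator H) x = g x) \<longleftrightarrow>
    (\<forall>K \<in> sets F. emeasure M (H \<inter> K) = (\<integral>\<^sup>+x. ennreal (g x) * indicator K x \<partial>M))"
    (is "?L \<longleftrightarrow> ?R")
proof -
  have gM[measurable]: "g \<in> borel_measurable M"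
    by (rule measurable_from_subalg[OF subalg g])
  have FM: "K \<in> sets M" if "K \<in> sets F" for K
    using that subalg by (auto simp: subalgebra_def)
  have ind: "(LINT x:K|M. indicator H x) = measure M (H \<inter> K)" if "K \<in> sets F" for K
  proof -
    have "(LINT x:K|M. indicator H x) = (LINT x|M. indicat_real (H \<inter> K) x)"
      unfolding set_lebesgue_integral_def
      by (intro Bochner_Integration.integral_cong) (auto split: split_indicator)
    also have "\<dots> = measure M (H \<inter> K)"
      using FM[OF that] sets.sets_into_space[OF H] by (simp add: Int_absorb2 le_infI1)
    finally show ?thesis .
  qed
  have intH: "integrable M (indicator H :: 'a \<Rightarrow> real)"
    by (simp add: less_top[symmetric])
  have nnint: "(\<integral>\<^sup>+x. ennreal (g x) * indicator K x \<partial>M) = ennreal (LINT x:K|M. g x)"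
    if "integrable M g" "K \<in> sets F" for K
  proof -
    have "integrable M (\<lambda>x. indicator K x * g x)"
      using that FM integrable_mult_indicator[of K M g] by simp
    then have "ennreal (LINT x:K|M. g x) = (\<integral>\<^sup>+x. ennreal (indicator K x * g x) \<partial>M)"
      unfolding set_lebesgue_integral_def using nonneg
      by (simp add: nn_integral_eq_integral)
    also have "\<dots> = (\<integral>\<^sup>+x. ennreal (g x) * indicator K x \<partial>M)"
      by (intro nn_integral_cong) (auto split: split_indicator)
    finally show ?thesis ..
  qed
  show ?thesis
  proof
    assume L: ?L
    have "integrable M g"
      by (rule integrable_cong_AE_imp[OF real_cond_exp_int(1)[OF intH]]) (use L in auto)
    show ?R
    proof
      fix K assume K: "K \<in> sets F"
      have "measure M (H \<inter> K) = (LINT x:K|M. real_cond_exp M F (indicator H) x)"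
        using real_cond_exp_intA[OF intH K] ind[OF K] by simp
      also have "\<dots> = (LINT x:K|M. g x)"
        unfolding set_lebesgue_integral_def using L FM[OF K]
        by (intro integral_cong_AE) auto
      finally show "emeasure M (H \<inter> K) = (\<integral>\<^sup>+x. ennreal (g x) * indicator K x \<partial>M)"
        using nnint[OF \<open>integrable M g\<close> K] by (simp add: emeasure_eq_measure)
    qed
  next
    assume R: ?R
    \<comment> \<open>The test set \<open>K = space M\<close> bounds the integral of
      \<open>g\<close> by the measure of \<open>H\<close>.\<close>
    have "space M \<in> sets F"
      using subalg by (metis sets.top subalgebra_def)
    with R have "(\<integral>\<^sup>+x. ennreal (g x) \<partial>M) = emeasure M (H \<inter> space M)"
      by (auto intro!: nn_integral_cong)
    also have "\<dots> < \<infinity>"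
      by (simp add: less_top[symmetric])
    finally have "integrable M g"
      using nonneg by (intro integrableI_nonneg) auto
    show ?L
    proof (rule real_cond_exp_charact[OF _ intH \<open>integrable M g\<close> g])
      fix K assume K: "K \<in> sets F"
      have "ennreal (measure M (H \<inter> K)) = ennreal (LINT x:K|M. g x)"
        using R K nnint[OF \<open>integrable M g\<close> K] by (simp add: emeasure_eq_measure)
      moreover have "0 \<le> (LINT x:K|M. g x)"
        unfolding set_lebesgue_integral_def using nonneg
        by (intro Bochner_Integration.integral_nonneg) auto
      ultimately show "(LINT x:K|M. indicator H x) = (LINT x:K|M. g x)"
        using ind[OF K] by simp
    qed
  qed
qed

text \<open>A general change of variables adds a Jacobian term to differential entropy. Here
  \<open>\<phi>\<close> preserves the reference measure, so the density merely gets composed with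
  it. The intended \<open>\<phi>\<close> merges blocks of coordinates, and \<open>\<psi>\<close>
  splits them again.\<close>

lemma (in information_space) finite_entropy_transport:
  assumes p: "finite_entropy N Y p"
    and phi[measurable]: "\<phi> \<in> measurable N' N" and distr: "distr N' N \<phi> = N"
    and psi[measurable]: "\<psi> \<in> measurable N N'" and inv: "\<And>x. x \<in> space N' \<Longrightarrow> \<psi> (\<phi> x) = x"
  shows "finite_entropy N' (\<lambda>\<omega>. \<psi> (Y \<omega>)) (\<lambda>x. p (\<phi> x))"
    and "entropy b N' (\<lambda>\<omega>. \<psi> (Y \<omega>)) = entropy b N Y"
proof -
  note dist = finite_entropy_distributed[OF p]
  note [measurable] = finite_entropy_measurable[OF p] distributed_measurable[OF dist]
  have nn: "0 \<le> p (\<phi> x)" if "x \<in> space N'" for x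
    using that by (intro finite_entropy_nn[OF p] measurable_space[OF phi])
  have dist': "distributed M N' (\<lambda>\<omega>. \<psi> (Y \<omega>)) (\<lambda>x. p (\<phi> x))"
    unfolding distributed_def
  proof (intro conjI measure_eqI)
    fix A assume "A \<in> sets (distr M N' (\<lambda>\<omega>. \<psi> (Y \<omega>)))"
    then have A[measurable]: "A \<in> sets N'" by simp
    let ?B = "\<psi> -` A \<inter> space N"
    have "emeasure (distr M N' (\<lambda>\<omega>. \<psi> (Y \<omega>))) A = emeasure M (Y -` ?B \<inter> space M)"
      using measurable_space[OF distributed_measurable[OF dist]]
      by (auto simp: emeasure_distr intro!: arg_cong[where f = "emeasure M"])
    also have "\<dots> = (\<integral>\<^sup>+x. ennreal (p x) * indicator ?B x \<partial>N)"
      by (intro distributed_emeasure[OF dist]) measurable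
    \<comment> \<open>Viewing \<open>N\<close> as the image of \<open>N'\<close> moves the integral
      to \<open>N'\<close>, where \<open>?B\<close> pulls back to \<open>A\<close> because
      \<open>\<psi>\<close> undoes \<open>\<phi>\<close>.\<close>
    also have "\<dots> = (\<integral>\<^sup>+x. ennreal (p x) * indicator ?B x \<partial>distr N' N \<phi>)"
      by (simp add: distr)
    also have "\<dots> = (\<integral>\<^sup>+x. ennreal (p (\<phi> x)) * indicator ?B (\<phi> x) \<partial>N')"
      by (subst nn_integral_distr) auto
    also have "\<dots> = (\<integral>\<^sup>+x. ennreal (p (\<phi> x)) * indicator A x \<partial>N')"
      using measurable_space[OF phi] inv
      by (intro nn_integral_cong) (auto split: split_indicator)
    finally show "emeasure (distr M N' (\<lambda>\<omega>. \<psi> (Y \<omega>))) A =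
        emeasure (density N' (\<lambda>x. ennreal (p (\<phi> x)))) A"
      by (simp add: emeasure_density)
  qed auto
  have "integrable (distr N' N \<phi>) (\<lambda>x. p x * log b (p x))"
    using finite_entropy_integrable[OF p] by (simp add: distr)
  then have "integrable N' (\<lambda>x. p (\<phi> x) * log b (p (\<phi> x)))"
    by (subst (asm) integrable_distr_eq) auto
  with dist' nn show "finite_entropy N' (\<lambda>\<omega>. \<psi> (Y \<omega>)) (\<lambda>x. p (\<phi> x))"
    by (simp add: finite_entropy_def)
  have "entropy b N Y = - (\<integral>x. p x * log b (p x) \<partial>distr N' N \<phi>)"
    using entropy_distr[OF dist finite_entropy_nn[OF p]] by (simp add: distr)
  also have "\<dots> = - (\<integral>x. p (\<phi> x) * log b (p (\<phi> x)) \<partial>N')"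
    by (subst integral_distr) auto
  finally show "entropy b N' (\<lambda>\<omega>. \<psi> (Y \<omega>)) = entropy b N Y"
    using entropy_distr[OF dist' nn] by simp
qed

text \<open>This is \<open>0\<close> where \<open>pz z = 0\<close>, and \<open>enn2real\<close> maps an infinite integral, which occurs only on
  a null set of \<open>z\<close>, to \<open>0\<close>.\<close>

definition cond_prob_given ::
  "'c measure \<Rightarrow> ('c \<times> 'd \<Rightarrow> real) \<Rightarrow> ('d \<Rightarrow> real) \<Rightarrow> 'c set \<Rightarrow> 'd \<Rightarrow> real" where
  "cond_prob_given S pxz pz A z =
    enn2real (\<integral>\<^sup>+x. ennreal (pxz (x, z)) * indicator A x \<partial>S) / pz z"

lemma cond_prob_given_nonneg: "0 \<le> pz z \<Longrightarrow> 0 \<le> cond_prob_given S pxz pz A z"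
  by (simp add: cond_prob_given_def)

lemma (in sigma_finite_measure) cond_prob_given_measurable [measurable]:
  assumes [measurable]: "pxz \<in> borel_measurable (M \<Otimes>\<^sub>M P)" "pz \<in> borel_measurable P" "A \<in> sets M"
  shows "cond_prob_given M pxz pz A \<in> borel_measurable P"
  unfolding cond_prob_given_def by measurable

text \<open>For almost every \<open>z\<close> the integral over \<open>A\<close> is bounded by the
  full integral, which is the marginal density \<open>pz z\<close>. Hence it is finite and vanishes
  together with \<open>pz z\<close>, so neither \<open>enn2real\<close> nor the division by zero
  loses anything.\<close>

lemma (in prob_space) nn_integral_density_slice:
  fixes pz :: "'d \<Rightarrow> real" and pxz :: "'c \<times> 'd \<Rightarrow> real"
  assumes S: "sigma_finite_measure S" and P: "sigma_finite_measure P"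
    and Z: "distributed M P Z pz" and pz_nonneg: "\<And>z. z \<in> space P \<Longrightarrow> 0 \<le> pz z"
    and XZ: "distributed M (S \<Otimes>\<^sub>M P) (\<lambda>\<omega>. (X \<omega>, Z \<omega>)) pxz"
  shows "AE z in P. (\<integral>\<^sup>+x. ennreal (pxz (x, z)) * indicator A x \<partial>S) =
    ennreal (pz z * cond_prob_given S pxz pz A z)"
  using distributed_marginal_eq_joint2[OF P S Z XZ] AE_space
proof eventually_elim
  fix z assume z: "ennreal (pz z) = (\<integral>\<^sup>+x. ennreal (pxz (x, z)) \<partial>S)" "z \<in> space P"
  let ?h = "\<integral>\<^sup>+x. ennreal (pxz (x, z)) * indicator A x \<partial>S"
  have le: "?h \<le> ennreal (pz z)"
    unfolding z by (intro nn_integral_mono) (auto split: split_indicator)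
  then have "?h < \<top>"
    by (rule le_less_trans) simp
  then have fin: "ennreal (enn2real ?h) = ?h"
    by simp
  show "?h = ennreal (pz z * cond_prob_given S pxz pz A z)"
  proof (cases "pz z = 0")
    case True
    then show ?thesis using le by (simp add: cond_prob_given_def)
  next
    case False
    then show ?thesis by (simp add: fin cond_prob_given_def)
  qed
qed

text \<open>The bridge from conditional expectations to densities. It is tested on preimages of sets
  \<open>B\<close> under \<open>Z\<close>: Tonelli's theorem expresses the joint probability as an
  integral of slices over \<open>B\<close>.\<close>

lemma (in prob_space) real_cond_exp_density:
  fixes pz :: "'d \<Rightarrow> real" and pxz :: "'c \<times> 'd \<Rightarrow> real"
  assumes S: "sigma_finite_measure S" and P: "sigma_finite_measure P"
    and Z: "distributed M P Z pz" and pz_nonneg: "\<And>z. z \<in> space P \<Longrightarrow> 0 \<le> pz z"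
    and XZ: "distributed M (S \<Otimes>\<^sub>M P) (\<lambda>\<omega>. (X \<omega>, Z \<omega>)) pxz"
    and pxz_nonneg: "\<And>v. v \<in> space (S \<Otimes>\<^sub>M P) \<Longrightarrow> 0 \<le> pxz v"
    and A: "A \<in> sets S"
  shows "AE \<omega> in M. real_cond_exp M (vimage_algebra (space M) Z P)
      (indicator (X -` A \<inter> space M)) \<omega> =
    cond_prob_given S pxz pz A (Z \<omega>)"
proof -
  interpret S: sigma_finite_measure S by fact
  interpret P: sigma_finite_measure P by fact
  interpret SP: pair_sigma_finite S P ..
  note [measurable] = A distributed_measurable[OF Z] distributed_real_measurable[OF pz_nonneg Z]
    distributed_real_measurable[OF pxz_nonneg XZ]
  let ?F = "vimage_algebra (space M) Z P"
  have X[measurable]: "X \<in> measurable M S"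
    using measurable_compose[OF distributed_measurable[OF XZ] measurable_fst] by simp
  have Zspace: "Z \<in> space M \<rightarrow> space P"
    using measurable_space[OF distributed_measurable[OF Z]] by auto
  have sub: "subalgebra M ?F"
    using sets_image_in_sets[OF refl distributed_measurable[OF Z]] by (simp add: subalgebra_def)
  interpret finite_measure_subalgebra M ?F
    by standard (fact sub)
  let ?g = "cond_prob_given S pxz pz A"
  have slice: "AE z in P. (\<integral>\<^sup>+x. ennreal (pxz (x, z)) * indicator A x \<partial>S) = ennreal (pz z * ?g z)"
    by (rule nn_integral_density_slice[OF S P Z pz_nonneg XZ])
  show ?thesis
  proof (subst real_cond_exp_indicator_eq_iff)
    show "(\<lambda>\<omega>. ?g (Z \<omega>)) \<in> borel_measurable ?F"
      using measurable_vimage_algebra1[OF Zspace] by measurable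
    show "\<forall>K \<in> sets ?F. emeasure M (X -` A \<inter> space M \<inter> K) =
        (\<integral>\<^sup>+\<omega>. ennreal (?g (Z \<omega>)) * indicator K \<omega> \<partial>M)"
    proof
      fix K assume "K \<in> sets ?F"
      then obtain B where B[measurable]: "B \<in> sets P" and K: "K = Z -` B \<inter> space M"
        using Zspace by (auto simp: sets_vimage_algebra2)
      have "X -` A \<inter> space M \<inter> K = (\<lambda>\<omega>. (X \<omega>, Z \<omega>)) -` (A \<times> B) \<inter> space M"
        by (auto simp: K)
      then have "emeasure M (X -` A \<inter> space M \<inter> K) =
          (\<integral>\<^sup>+v. ennreal (pxz v) * indicator (A \<times> B) v \<partial>(S \<Otimes>\<^sub>M P))"
        by (simp add: distributed_emeasure[OF XZ])
      also have "\<dots> = (\<integral>\<^sup>+z. \<integral>\<^sup>+x. ennreal (pxz (x, z)) * indicator (A \<times> B) (x, z) \<partial>S \<partial>P)"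
        by (intro SP.nn_integral_snd[symmetric]) measurable
      also have "\<dots> = (\<integral>\<^sup>+z. (\<integral>\<^sup>+x. ennreal (pxz (x, z)) * indicator A x \<partial>S) * indicator B z \<partial>P)"
        by (intro nn_integral_cong, subst nn_integral_multc[symmetric])
          (auto intro!: nn_integral_cong split: split_indicator)
      \<comment> \<open>Each slice carries a factor \<open>pz z\<close>; being the density of
        \<open>Z\<close>, it turns the integral over \<open>P\<close> back into one over
        \<open>M\<close>.\<close>
      also have "\<dots> = (\<integral>\<^sup>+z. ennreal (pz z) * (ennreal (?g z) * indicator B z) \<partial>P)"
        using slice AE_space
        by (intro nn_integral_cong_AE, eventually_elim)
          (auto simp: pz_nonneg cond_prob_given_nonneg ennreal_mult split: split_indicator)
      also have "\<dots> = (\<integral>\<^sup>+\<omega>. ennreal (?g (Z \<omega>)) * indicator B (Z \<omega>) \<partial>M)"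
        by (intro distributed_nn_integral[OF Z]) measurable
      also have "\<dots> = (\<integral>\<^sup>+\<omega>. ennreal (?g (Z \<omega>)) * indicator K \<omega> \<partial>M)"
        by (intro nn_integral_cong) (auto simp: K split: split_indicator)
      finally show "emeasure M (X -` A \<inter> space M \<inter> K) =
          (\<integral>\<^sup>+\<omega>. ennreal (?g (Z \<omega>)) * indicator K \<omega> \<partial>M)" .
    qed
  qed (use Zspace pz_nonneg in \<open>auto intro!: cond_prob_given_nonneg\<close>)
qed

section \<open>Conditional mutual information\<close>

text \<open>In the application \<open>S\<close>, \<open>T\<close>, \<open>P\<close> are Lebesgue
  measures on three disjoint sets of coordinates and \<open>X\<close>, \<open>Y\<close>,
  \<open>Z\<close> the corresponding subvectors.\<close>

locale density_triple = information_space M b +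
  S: sigma_finite_measure S + T: sigma_finite_measure T + P: sigma_finite_measure P
  for M :: "'a measure" and b :: real
    and S :: "'c measure" and T :: "'d measure" and P :: "'e measure" +
  fixes X :: "'a \<Rightarrow> 'c" and Y :: "'a \<Rightarrow> 'd" and Z :: "'a \<Rightarrow> 'e"
    and pz :: "'e \<Rightarrow> real" and pxz :: "'c \<times> 'e \<Rightarrow> real" and pyz :: "'d \<times> 'e \<Rightarrow> real"
    and pxyz :: "'c \<times> 'd \<times> 'e \<Rightarrow> real"
  assumes Z: "finite_entropy P Z pz"
    and XZ: "finite_entropy (S \<Otimes>\<^sub>M P) (\<lambda>\<omega>. (X \<omega>, Z \<omega>)) pxz"
    and YZ: "finite_entropy (T \<Otimes>\<^sub>M P) (\<lambda>\<omega>. (Y \<omega>, Z \<omega>)) pyz"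
    and XYZ: "finite_entropy (S \<Otimes>\<^sub>M T \<Otimes>\<^sub>M P) (\<lambda>\<omega>. (X \<omega>, Y \<omega>, Z \<omega>)) pxyz"
begin

sublocale TP: pair_sigma_finite T P ..
sublocale STP: pair_sigma_finite S "T \<Otimes>\<^sub>M P" ..

lemmas dist_Z = finite_entropy_distributed[OF Z]
  and dist_XZ = finite_entropy_distributed[OF XZ]
  and dist_YZ = finite_entropy_distributed[OF YZ]
  and dist_XYZ = finite_entropy_distributed[OF XYZ]

lemmas nonneg_Z = finite_entropy_nn[OF Z]
  and nonneg_XZ = finite_entropy_nn[OF XZ]
  and nonneg_YZ = finite_entropy_nn[OF YZ]
  and nonneg_XYZ = finite_entropy_nn[OF XYZ]

lemma measurable_densities [measurable]:
  "pz \<in> borel_measurable P" "pxz \<in> borel_measurable (S \<Otimes>\<^sub>M P)"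
  "pyz \<in> borel_measurable (T \<Otimes>\<^sub>M P)" "pxyz \<in> borel_measurable (S \<Otimes>\<^sub>M T \<Otimes>\<^sub>M P)"
  by (rule finite_entropy_measurable; rule Z XZ YZ XYZ)+

lemma measurable_variables [measurable]:
  "X \<in> measurable M S" "Y \<in> measurable M T" "Z \<in> measurable M P"
  using measurable_compose[OF distributed_measurable[OF dist_XZ] measurable_fst]
    measurable_compose[OF distributed_measurable[OF dist_YZ] measurable_fst]
    distributed_measurable[OF dist_Z]
  by simp_all

text \<open>The density of the law that has the same \<open>(X, Z)\<close> and \<open>(Y, Z)\<close> marginals as the given one but
  makes \<open>X\<close> and \<open>Y\<close> conditionally independent given \<open>Z\<close>. Where \<open>pz = 0\<close> it is \<open>0\<close> by the
  convention \<open>x / 0 = 0\<close>.\<close>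

definition q :: "'c \<times> 'd \<times> 'e \<Rightarrow> real" where
  "q = (\<lambda>(x, y, z). pxz (x, z) * pyz (y, z) / pz z)"

lemma measurable_q [measurable]: "q \<in> borel_measurable (S \<Otimes>\<^sub>M T \<Otimes>\<^sub>M P)"
  unfolding q_def by measurable

lemma q_nonneg: "v \<in> space (S \<Otimes>\<^sub>M T \<Otimes>\<^sub>M P) \<Longrightarrow> 0 \<le> q v"
  using nonneg_Z nonneg_XZ nonneg_YZ by (auto simp: q_def space_pair_measure)

abbreviation "phi \<equiv> cond_prob_given S pxz pz"
abbreviation "psi \<equiv> cond_prob_given T pyz pz"

text \<open>For fixed \<open>z\<close> the density \<open>q\<close> is a function of
  \<open>x\<close> times a function of \<open>y\<close>, so the inner integrals give the two slices
  divided by \<open>pz z\<close>, that is \<open>pz z * phi A z * psi B z\<close> almost everywhere.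
  The remaining factor \<open>pz z\<close> is the density of \<open>Z\<close>.\<close>

lemma emeasure_q_rectangle:
  assumes A[measurable]: "A \<in> sets S" and B[measurable]: "B \<in> sets T" and C[measurable]: "C \<in> sets P"
  shows "emeasure (density (S \<Otimes>\<^sub>M T \<Otimes>\<^sub>M P) q) (A \<times> B \<times> C) =
    (\<integral>\<^sup>+\<omega>. ennreal (phi A (Z \<omega>) * psi B (Z \<omega>)) * indicator C (Z \<omega>) \<partial>M)"
proof -
  let ?f = "\<lambda>z. \<integral>\<^sup>+x. ennreal (pxz (x, z)) * indicator A x \<partial>S"
  let ?g = "\<lambda>z. \<integral>\<^sup>+y. ennreal (pyz (y, z)) * indicator B y \<partial>T"
  have f: "AE z in P. ?f z = ennreal (pz z * phi A z)"
    by (rule nn_integral_density_slice[OF S.sigma_finite_measure_axioms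
          P.sigma_finite_measure_axioms dist_Z nonneg_Z dist_XZ])
  have g: "AE z in P. ?g z = ennreal (pz z * psi B z)"
    by (rule nn_integral_density_slice[OF T.sigma_finite_measure_axioms
          P.sigma_finite_measure_axioms dist_Z nonneg_Z dist_YZ])
  have "emeasure (density (S \<Otimes>\<^sub>M T \<Otimes>\<^sub>M P) q) (A \<times> B \<times> C) =
      (\<integral>\<^sup>+v. ennreal (q v) * indicator (A \<times> B \<times> C) v \<partial>(S \<Otimes>\<^sub>M T \<Otimes>\<^sub>M P))"
    by (intro emeasure_density) measurable
  also have "\<dots> = (\<integral>\<^sup>+w. \<integral>\<^sup>+x. ennreal (q (x, w)) * indicator (A \<times> B \<times> C) (x, w) \<partial>S \<partial>(T \<Otimes>\<^sub>M P))"
    by (intro STP.nn_integral_snd[symmetric]) measurable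
  also have "\<dots> = (\<integral>\<^sup>+z. \<integral>\<^sup>+y. \<integral>\<^sup>+x. ennreal (q (x, y, z)) * indicator (A \<times> B \<times> C) (x, y, z) \<partial>S \<partial>T \<partial>P)"
    by (subst TP.nn_integral_snd[symmetric]) measurable
  also have "\<dots> = (\<integral>\<^sup>+z. ?f z * ?g z * ennreal (1 / pz z) * indicator C z \<partial>P)"
  proof (rule nn_integral_cong)
    fix z assume z: "z \<in> space P"
    have "(\<integral>\<^sup>+y. \<integral>\<^sup>+x. ennreal (q (x, y, z)) * indicator (A \<times> B \<times> C) (x, y, z) \<partial>S \<partial>T) =
      (\<integral>\<^sup>+y. \<integral>\<^sup>+x. (ennreal (pxz (x, z)) * indicator A x) *
        ((ennreal (pyz (y, z)) * indicator B y) * (ennreal (1 / pz z) * indicator C z)) \<partial>S \<partial>T)"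
    proof (intro nn_integral_cong)
      fix x y assume "x \<in> space S" "y \<in> space T"
      then have "ennreal (q (x, y, z)) = ennreal (pxz (x, z)) * (ennreal (pyz (y, z)) * ennreal (1 / pz z))"
        using z nonneg_Z nonneg_XZ nonneg_YZ
        by (simp add: q_def space_pair_measure flip: ennreal_mult)
      then show "ennreal (q (x, y, z)) * indicator (A \<times> B \<times> C) (x, y, z) =
          (ennreal (pxz (x, z)) * indicator A x) *
          ((ennreal (pyz (y, z)) * indicator B y) * (ennreal (1 / pz z) * indicator C z))"
        by (auto split: split_indicator)
    qed
    also have "\<dots> = (\<integral>\<^sup>+y. ?f z * ((ennreal (pyz (y, z)) * indicator B y) *
        (ennreal (1 / pz z) * indicator C z)) \<partial>T)"
      using z by (intro nn_integral_cong nn_integral_multc) measurable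
    also have "\<dots> = ?f z * (?g z * (ennreal (1 / pz z) * indicator C z))"
      using z by (subst nn_integral_cmult, measurable, subst nn_integral_multc, measurable)
    finally show "(\<integral>\<^sup>+y. \<integral>\<^sup>+x. ennreal (q (x, y, z)) * indicator (A \<times> B \<times> C) (x, y, z) \<partial>S \<partial>T) =
        ?f z * ?g z * ennreal (1 / pz z) * indicator C z"
      by (simp add: mult.assoc)
  qed
  also have "\<dots> = (\<integral>\<^sup>+z. ennreal (pz z) * (ennreal (phi A z * psi B z) * indicator C z) \<partial>P)"
  proof (rule nn_integral_cong_AE)
    show "AE z in P. ?f z * ?g z * ennreal (1 / pz z) * indicator C z =
        ennreal (pz z) * (ennreal (phi A z * psi B z) * indicator C z)"
      using f g AE_space
    proof eventually_elim
      fix z assume fg: "?f z = ennreal (pz z * phi A z)" "?g z = ennreal (pz z * psi B z)"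
        and z: "z \<in> space P"
      have nn: "0 \<le> phi A z" "0 \<le> psi B z"
        using nonneg_Z[OF z] by (auto intro: cond_prob_given_nonneg)
      have "?f z * ?g z * ennreal (1 / pz z) = ennreal (pz z * phi A z * (pz z * psi B z) * (1 / pz z))"
        unfolding fg using nn nonneg_Z[OF z] by (simp flip: ennreal_mult)
      \<comment> \<open>This includes the case \<open>pz z = 0\<close>, where both sides are
        zero.\<close>
      also have "pz z * phi A z * (pz z * psi B z) * (1 / pz z) = pz z * (phi A z * psi B z)"
        by simp
      finally show "?f z * ?g z * ennreal (1 / pz z) * indicator C z =
          ennreal (pz z) * (ennreal (phi A z * psi B z) * indicator C z)"
        using nn nonneg_Z[OF z] by (simp add: ennreal_mult mult.assoc)
    qed
  qed
  also have "\<dots> = (\<integral>\<^sup>+\<omega>. ennreal (phi A (Z \<omega>) * psi B (Z \<omega>)) * indicator C (Z \<omega>) \<partial>M)"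
    by (intro distributed_nn_integral[OF dist_Z]) measurable
  finally show ?thesis .
qed

abbreviation "F \<equiv> vimage_algebra (space M) Z P"

sublocale F: finite_measure_subalgebra M F
  using sets_image_in_sets[OF refl measurable_variables(3)]
  by unfold_locales (simp add: subalgebra_def)

lemma cond_prob_X: "A \<in> sets S \<Longrightarrow>
    AE \<omega> in M. real_cond_exp M F (indicator (X -` A \<inter> space M)) \<omega> = phi A (Z \<omega>)"
  by (rule real_cond_exp_density[OF S.sigma_finite_measure_axioms
        P.sigma_finite_measure_axioms dist_Z nonneg_Z dist_XZ nonneg_XZ])

lemma cond_prob_Y: "B \<in> sets T \<Longrightarrow>
    AE \<omega> in M. real_cond_exp M F (indicator (Y -` B \<inter> space M)) \<omega> = psi B (Z \<omega>)"
  by (rule real_cond_exp_density[OF T.sigma_finite_measure_axioms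
        P.sigma_finite_measure_axioms dist_Z nonneg_Z dist_YZ nonneg_YZ])

text \<open>On the full rectangle, \<open>phi\<close> and \<open>psi\<close> are versions of the
  conditional probability of the sure event, hence almost surely 1, and the rectangle formula
  integrates the constant 1.\<close>

lemma prob_space_q: "prob_space (density (S \<Otimes>\<^sub>M T \<Otimes>\<^sub>M P) q)"
proof
  have one: "AE \<omega> in M. real_cond_exp M F (indicator (space M)) \<omega> = indicat_real (space M) \<omega>"
  proof (rule F.real_cond_exp_F_meas)
    show "indicat_real (space M) \<in> borel_measurable F"
      using sets.top[of F] by (intro borel_measurable_indicator) simp
  qed (simp add: less_top[symmetric])
  have "AE \<omega> in M. phi (space S) (Z \<omega>) * psi (space T) (Z \<omega>) = 1"
    using one cond_prob_X[OF sets.top] cond_prob_Y[OF sets.top] AE_space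
  proof eventually_elim
    case (elim \<omega>)
    have "X -` space S \<inter> space M = space M" "Y -` space T \<inter> space M = space M"
      using measurable_space[OF measurable_variables(1)] measurable_space[OF measurable_variables(2)]
      by auto
    with elim show ?case by simp
  qed
  then have "(\<integral>\<^sup>+\<omega>. ennreal (phi (space S) (Z \<omega>) * psi (space T) (Z \<omega>)) * indicator (space P) (Z \<omega>) \<partial>M) =
      (\<integral>\<^sup>+\<omega>. 1 \<partial>M)"
    using measurable_space[OF measurable_variables(3)]
    by (intro nn_integral_cong_AE) (auto elim: eventually_mono)
  then show "emeasure (density (S \<Otimes>\<^sub>M T \<Otimes>\<^sub>M P) q) (space (density (S \<Otimes>\<^sub>M T \<Otimes>\<^sub>M P) q)) = 1"
    using emeasure_q_rectangle[OF sets.top sets.top sets.top]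
    by (simp add: space_pair_measure emeasure_space_1)
qed

text \<open>For fixed \<open>A\<close> and \<open>B\<close>, the product formula for conditional
  probabilities holds almost surely iff it holds after integration over every event that
  \<open>Z\<close> lies in some \<open>C\<close>. These integrated identities say that the two laws
  agree on \<open>A \<times> B \<times> C\<close>.\<close>

lemma distr_eq_q_iff_cond_indep:
  "distr M (S \<Otimes>\<^sub>M T \<Otimes>\<^sub>M P) (\<lambda>\<omega>. (X \<omega>, Y \<omega>, Z \<omega>)) = density (S \<Otimes>\<^sub>M T \<Otimes>\<^sub>M P) q \<longleftrightarrow>
    (\<forall>G \<in> sets (vimage_algebra (space M) X S). \<forall>H \<in> sets (vimage_algebra (space M) Y T).
      AE \<omega> in M. real_cond_exp M F (indicator (G \<inter> H)) \<omega> =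
        real_cond_exp M F (indicator G) \<omega> * real_cond_exp M F (indicator H) \<omega>)"
  (is "?D = ?Q \<longleftrightarrow> ?CI")
proof -
  have sp: "X \<in> space M \<rightarrow> space S" "Y \<in> space M \<rightarrow> space T" "Z \<in> space M \<rightarrow> space P"
    using measurable_variables[THEN measurable_space] by auto
  have Fsets: "sets F = {Z -` C \<inter> space M | C. C \<in> sets P}"
    by (rule sets_vimage_algebra2[OF sp(3)])
  have step: "(AE \<omega> in M. real_cond_exp M F (indicator ((X -` A \<inter> space M) \<inter> (Y -` B \<inter> space M))) \<omega> =
        real_cond_exp M F (indicator (X -` A \<inter> space M)) \<omega> *
        real_cond_exp M F (indicator (Y -` B \<inter> space M)) \<omega>) \<longleftrightarrow>
      (\<forall>C \<in> sets P. emeasure ?D (A \<times> B \<times> C) = emeasure ?Q (A \<times> B \<times> C))"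
    if A[measurable]: "A \<in> sets S" and B[measurable]: "B \<in> sets T" for A B
  proof -
    let ?H = "(X -` A \<inter> space M) \<inter> (Y -` B \<inter> space M)"
    have "(AE \<omega> in M. real_cond_exp M F (indicator ?H) \<omega> =
        real_cond_exp M F (indicator (X -` A \<inter> space M)) \<omega> *
        real_cond_exp M F (indicator (Y -` B \<inter> space M)) \<omega>) \<longleftrightarrow>
      (AE \<omega> in M. real_cond_exp M F (indicator ?H) \<omega> = phi A (Z \<omega>) * psi B (Z \<omega>))"
    proof (rule eventually_subst)
      show "AE \<omega> in M. (real_cond_exp M F (indicator ?H) \<omega> =
          real_cond_exp M F (indicator (X -` A \<inter> space M)) \<omega> *
          real_cond_exp M F (indicator (Y -` B \<inter> space M)) \<omega>) =
        (real_cond_exp M F (indicator ?H) \<omega> = phi A (Z \<omega>) * psi B (Z \<omega>))"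
        using cond_prob_X[OF A] cond_prob_Y[OF B] by eventually_elim simp
    qed
    also have "\<dots> \<longleftrightarrow> (\<forall>K \<in> sets F. emeasure M (?H \<inter> K) =
        (\<integral>\<^sup>+\<omega>. ennreal (phi A (Z \<omega>) * psi B (Z \<omega>)) * indicator K \<omega> \<partial>M))"
    proof (rule F.real_cond_exp_indicator_eq_iff)
      show "(\<lambda>\<omega>. phi A (Z \<omega>) * psi B (Z \<omega>)) \<in> borel_measurable F"
        using measurable_vimage_algebra1[OF sp(3)] by measurable
    qed (use sp(3) nonneg_Z in \<open>auto intro!: mult_nonneg_nonneg cond_prob_given_nonneg\<close>)
    also have "\<dots> \<longleftrightarrow> (\<forall>C \<in> sets P. emeasure M (?H \<inter> (Z -` C \<inter> space M)) =
        (\<integral>\<^sup>+\<omega>. ennreal (phi A (Z \<omega>) * psi B (Z \<omega>)) * indicator (Z -` C \<inter> space M) \<omega> \<partial>M))"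
      unfolding Fsets by blast
    also have "\<dots> \<longleftrightarrow> (\<forall>C \<in> sets P. emeasure ?D (A \<times> B \<times> C) = emeasure ?Q (A \<times> B \<times> C))"
    proof (intro ball_cong refl arg_cong2[where f = "(=)"])
      fix C assume C[measurable]: "C \<in> sets P"
      show "emeasure M (?H \<inter> (Z -` C \<inter> space M)) = emeasure ?D (A \<times> B \<times> C)"
        by (subst emeasure_distr) (auto intro!: arg_cong[where f = "emeasure M"])
      show "(\<integral>\<^sup>+\<omega>. ennreal (phi A (Z \<omega>) * psi B (Z \<omega>)) * indicator (Z -` C \<inter> space M) \<omega> \<partial>M) =
          emeasure ?Q (A \<times> B \<times> C)"
        unfolding emeasure_q_rectangle[OF A B C]
        by (intro nn_integral_cong) (auto split: split_indicator)
    qed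
    finally show ?thesis .
  qed
  have "?CI \<longleftrightarrow> (\<forall>A \<in> sets S. \<forall>B \<in> sets T. \<forall>C \<in> sets P.
      emeasure ?D (A \<times> B \<times> C) = emeasure ?Q (A \<times> B \<times> C))"
    unfolding sets_vimage_algebra2[OF sp(1)] sets_vimage_algebra2[OF sp(2)] using step by blast
  moreover have "?D = ?Q" if "\<forall>A \<in> sets S. \<forall>B \<in> sets T. \<forall>C \<in> sets P.
      emeasure ?D (A \<times> B \<times> C) = emeasure ?Q (A \<times> B \<times> C)"
  proof (rule measure_eqI_triple_rectangles)
    show "finite_measure ?D"
      by (intro finite_measure_distr) measurable
  qed (use that in auto)
  ultimately show ?thesis
    by auto
qed

text \<open>The conditional mutual information I(X; Y | Z). Regrouped, it is H(X | Z) - H(X | Y, Z),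
  the amount by which \<open>Y\<close> lowers the conditional entropy of \<open>X\<close>.\<close>

definition "entropy_gap =
  entropy b (S \<Otimes>\<^sub>M P) (\<lambda>\<omega>. (X \<omega>, Z \<omega>)) + entropy b (T \<Otimes>\<^sub>M P) (\<lambda>\<omega>. (Y \<omega>, Z \<omega>)) -
  entropy b (S \<Otimes>\<^sub>M T \<Otimes>\<^sub>M P) (\<lambda>\<omega>. (X \<omega>, Y \<omega>, Z \<omega>)) - entropy b P Z"

text \<open>A joint density vanishes almost everywhere where one of its marginal densities does, and
  \<open>q\<close> vanishes only where one of three marginal densities is zero.\<close>

lemma q_zero: "AE v in S \<Otimes>\<^sub>M T \<Otimes>\<^sub>M P. q v = 0 \<longrightarrow> pxyz v = 0"
  and log_density_ratio: "AE v in S \<Otimes>\<^sub>M T \<Otimes>\<^sub>M P. pxyz v * log b (pxyz v / q v) =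
    pxyz v * log b (pxyz v) - pxyz v * log b (pxz (fst v, snd (snd v))) -
    pxyz v * log b (pyz (snd v)) + pxyz v * log b (pz (snd (snd v)))"
proof -
  have z: "AE v in S \<Otimes>\<^sub>M T \<Otimes>\<^sub>M P. pz (snd (snd v)) = 0 \<longrightarrow> pxyz v = 0"
    by (rule subdensity_finite_entropy[OF _ XYZ Z]) auto
  have xz: "AE v in S \<Otimes>\<^sub>M T \<Otimes>\<^sub>M P. pxz (fst v, snd (snd v)) = 0 \<longrightarrow> pxyz v = 0"
    by (rule subdensity_finite_entropy[OF _ XYZ XZ]) auto
  have yz: "AE v in S \<Otimes>\<^sub>M T \<Otimes>\<^sub>M P. pyz (snd v) = 0 \<longrightarrow> pxyz v = 0"
    by (rule subdensity_finite_entropy[OF _ XYZ YZ]) auto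
  from z xz yz show "AE v in S \<Otimes>\<^sub>M T \<Otimes>\<^sub>M P. q v = 0 \<longrightarrow> pxyz v = 0"
    by eventually_elim (auto simp: q_def split: prod.splits)
  from z xz yz AE_space show "AE v in S \<Otimes>\<^sub>M T \<Otimes>\<^sub>M P. pxyz v * log b (pxyz v / q v) =
    pxyz v * log b (pxyz v) - pxyz v * log b (pxz (fst v, snd (snd v))) -
    pxyz v * log b (pyz (snd v)) + pxyz v * log b (pz (snd (snd v)))"
  proof eventually_elim
    case (elim v)
    show ?case
    proof (cases "pxyz v = 0")
      case False
      obtain x y z where v: "v = (x, y, z)"
        by (cases v)
      \<comment> \<open>Positivity of all four densities allows the logarithm of the quotient to be
        expanded. In the other case every term has the factor \<open>pxyz v = 0\<close>.\<close>
      have "0 < pxyz v" "0 < pz z" "0 < pxz (x, z)" "0 < pyz (y, z)"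
        using False elim nonneg_XYZ[of v] nonneg_Z[of z] nonneg_XZ[of "(x, z)"] nonneg_YZ[of "(y, z)"]
        by (auto simp: v space_pair_measure less_le)
      then show ?thesis
        using b_gt_1 by (simp add: q_def v log_divide_pos log_mult_pos algebra_simps)
    qed simp
  qed
qed

text \<open>Integrating the logarithm of a marginal density against the joint density gives minus
  the entropy of that marginal. Finite entropy makes each of the four terms integrable, so the
  integral of their sum may be split.\<close>

lemma integrable_log_density_ratio:
  "integrable (S \<Otimes>\<^sub>M T \<Otimes>\<^sub>M P) (\<lambda>v. pxyz v * log b (pxyz v / q v))"
  and integral_log_density_ratio:
  "(\<integral>v. pxyz v * log b (pxyz v / q v) \<partial>(S \<Otimes>\<^sub>M T \<Otimes>\<^sub>M P)) = entropy_gap"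
proof -
  let ?N = "S \<Otimes>\<^sub>M T \<Otimes>\<^sub>M P"
  let ?r = "\<lambda>v. pxyz v * log b (pxyz v) - pxyz v * log b (pxz (fst v, snd (snd v))) -
    pxyz v * log b (pyz (snd v)) + pxyz v * log b (pz (snd (snd v)))"
  have i: "integrable ?N (\<lambda>v. pxyz v * log b (pxyz v))"
    by (rule finite_entropy_integrable[OF XYZ])
  have iz: "integrable ?N (\<lambda>v. pxyz v * log b (pz (snd (snd v))))"
    by (rule finite_entropy_integrable_transform[OF Z dist_XYZ nonneg_XYZ]) auto
  have ixz: "integrable ?N (\<lambda>v. pxyz v * log b (pxz (fst v, snd (snd v))))"
    by (rule finite_entropy_integrable_transform[OF XZ dist_XYZ nonneg_XYZ]) auto
  have iyz: "integrable ?N (\<lambda>v. pxyz v * log b (pyz (snd v)))"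
    by (rule finite_entropy_integrable_transform[OF YZ dist_XYZ nonneg_XYZ]) auto
  have r: "integrable ?N ?r"
    using i iz ixz iyz by simp
  show "integrable ?N (\<lambda>v. pxyz v * log b (pxyz v / q v))"
    by (rule integrable_cong_AE_imp[OF r])
      (use log_density_ratio in \<open>auto elim: eventually_mono\<close>)
  have "(\<integral>v. pxyz v * log b (pxyz v / q v) \<partial>?N) = (\<integral>v. ?r v \<partial>?N)"
    by (rule integral_cong_AE[OF _ _ log_density_ratio]) measurable
  also have "\<dots> = (\<integral>v. pxyz v * log b (pxyz v) \<partial>?N) - (\<integral>v. pxyz v * log b (pxz (fst v, snd (snd v))) \<partial>?N) -
      (\<integral>v. pxyz v * log b (pyz (snd v)) \<partial>?N) + (\<integral>v. pxyz v * log b (pz (snd (snd v))) \<partial>?N)"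
    using i iz ixz iyz by simp
  also have "(\<integral>v. pxyz v * log b (pz (snd (snd v))) \<partial>?N) = - entropy b P Z"
    using distributed_transform_integral[OF dist_XYZ nonneg_XYZ dist_Z nonneg_Z,
        where T = "\<lambda>v. snd (snd v)" and f = "\<lambda>v. log b (pz v)"]
    by (simp add: comp_def entropy_distr[OF dist_Z nonneg_Z])
  also have "(\<integral>v. pxyz v * log b (pxz (fst v, snd (snd v))) \<partial>?N) =
      - entropy b (S \<Otimes>\<^sub>M P) (\<lambda>\<omega>. (X \<omega>, Z \<omega>))"
    using distributed_transform_integral[OF dist_XYZ nonneg_XYZ dist_XZ nonneg_XZ,
        where T = "\<lambda>v. (fst v, snd (snd v))" and f = "\<lambda>v. log b (pxz v)"]
    by (simp add: comp_def entropy_distr[OF dist_XZ nonneg_XZ])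
  also have "(\<integral>v. pxyz v * log b (pyz (snd v)) \<partial>?N) =
      - entropy b (T \<Otimes>\<^sub>M P) (\<lambda>\<omega>. (Y \<omega>, Z \<omega>))"
    using distributed_transform_integral[OF dist_XYZ nonneg_XYZ dist_YZ nonneg_YZ,
        where T = "snd" and f = "\<lambda>v. log b (pyz v)"]
    by (simp add: comp_def entropy_distr[OF dist_YZ nonneg_YZ])
  finally show "(\<integral>v. pxyz v * log b (pxyz v / q v) \<partial>?N) = entropy_gap"
    by (simp add: entropy_gap_def entropy_distr[OF dist_XYZ nonneg_XYZ])
qed

text \<open>Gibbs' inequality with its equality case. The law with density \<open>q\<close> is the
  reference because \<open>q_zero\<close> provides absolute continuity in this direction;
  \<open>pxyz\<close> may vanish where \<open>q\<close> does not.\<close>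

lemma
  shows entropy_gap_nonneg: "0 \<le> entropy_gap"
    and entropy_gap_eq_0_iff: "entropy_gap = 0 \<longleftrightarrow>
      distr M (S \<Otimes>\<^sub>M T \<Otimes>\<^sub>M P) (\<lambda>\<omega>. (X \<omega>, Y \<omega>, Z \<omega>)) = density (S \<Otimes>\<^sub>M T \<Otimes>\<^sub>M P) q"
proof -
  let ?N = "S \<Otimes>\<^sub>M T \<Otimes>\<^sub>M P"
  have distr: "distr M ?N (\<lambda>\<omega>. (X \<omega>, Y \<omega>, Z \<omega>)) = density ?N pxyz"
    by (rule distributed_distr_eq_density[OF dist_XYZ])
  have p: "prob_space (density ?N pxyz)"
    unfolding distr[symmetric] by (intro prob_space_distr) measurable
  have nn: "AE v in ?N. 0 \<le> q v" "AE v in ?N. 0 \<le> pxyz v"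
    using q_nonneg nonneg_XYZ by auto
  have KL: "KL_divergence b (density ?N q) (density ?N pxyz) = entropy_gap"
    using STP.KL_density_density[OF b_gt_1 measurable_q nn(1) measurable_densities(4) nn(2) q_zero]
    by (simp add: integral_log_density_ratio)
  show "0 \<le> entropy_gap"
    using STP.KL_density_density_nonneg[OF b_gt_1 measurable_q nn(1) prob_space_q
        measurable_densities(4) nn(2) p q_zero integrable_log_density_ratio]
    by (simp add: KL)
  show "entropy_gap = 0 \<longleftrightarrow> distr M ?N (\<lambda>\<omega>. (X \<omega>, Y \<omega>, Z \<omega>)) = density ?N q"
    using STP.KL_density_density_eq_0_iff[OF b_gt_1 measurable_q nn(1) prob_space_q
        measurable_densities(4) nn(2) p q_zero integrable_log_density_ratio]
    by (simp add: KL distr)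
qed

end

section \<open>Differential entropy of subvectors\<close>

lemma product_sigma_finite_lborel: "product_sigma_finite (\<lambda>_. lborel)"
  by standard

lemma sigma_finite_PiM_lborel: "finite I \<Longrightarrow> sigma_finite_measure (Pi\<^sub>M I (\<lambda>_. lborel))"
  by (rule product_sigma_finite.sigma_finite[OF product_sigma_finite_lborel])

lemma distr_merge_lborel:
  assumes "finite I" "finite J" "I \<inter> J = {}"
  shows "distr (Pi\<^sub>M I (\<lambda>_. lborel) \<Otimes>\<^sub>M Pi\<^sub>M J (\<lambda>_. lborel)) (Pi\<^sub>M (I \<union> J) (\<lambda>_. lborel)) (merge I J) =
    Pi\<^sub>M (I \<union> J) (\<lambda>_. lborel)"
  using assms by (intro product_sigma_finite.distr_merge[OF product_sigma_finite_lborel])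

text \<open>Two binary merges in succession: the map \<open>?g\<close> acts as the identity on the
  first factor and merges the other two, so its image measure is a product of image measures; the
  outer merge then attaches \<open>I\<close>.\<close>

lemma distr_merge3_lborel:
  fixes I J K :: "'i set"
  assumes fin: "finite I" "finite J" "finite K" and disj: "I \<inter> J = {}" "I \<inter> K = {}" "J \<inter> K = {}"
  defines "L \<equiv> \<lambda>I :: 'i set. Pi\<^sub>M I (\<lambda>_. lborel :: real measure)"
  shows "(\<lambda>(x, y, z). merge I (J \<union> K) (x, merge J K (y, z))) \<in>
      measurable (L I \<Otimes>\<^sub>M L J \<Otimes>\<^sub>M L K) (L (I \<union> J \<union> K))"
    and "distr (L I \<Otimes>\<^sub>M L J \<Otimes>\<^sub>M L K) (L (I \<union> J \<union> K))
      (\<lambda>(x, y, z). merge I (J \<union> K) (x, merge J K (y, z))) = L (I \<union> J \<union> K)"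
proof -
  let ?g = "\<lambda>(x, w). (x, merge J K w)"
  have g: "?g \<in> measurable (L I \<Otimes>\<^sub>M L J \<Otimes>\<^sub>M L K) (L I \<Otimes>\<^sub>M L (J \<union> K))"
    unfolding L_def by measurable
  have h: "merge I (J \<union> K) \<in> measurable (L I \<Otimes>\<^sub>M L (J \<union> K)) (L (I \<union> J \<union> K))"
    unfolding L_def Un_assoc by measurable
  have eq: "(\<lambda>(x, y, z). merge I (J \<union> K) (x, merge J K (y, z))) = merge I (J \<union> K) \<circ> ?g"
    by auto
  show "(\<lambda>(x, y, z). merge I (J \<union> K) (x, merge J K (y, z))) \<in>
      measurable (L I \<Otimes>\<^sub>M L J \<Otimes>\<^sub>M L K) (L (I \<union> J \<union> K))"
    unfolding eq by (rule measurable_comp[OF g h])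
  have "distr (L I \<Otimes>\<^sub>M L J \<Otimes>\<^sub>M L K) (L I \<Otimes>\<^sub>M L (J \<union> K)) ?g =
      distr (L I) (L I) (\<lambda>x. x) \<Otimes>\<^sub>M distr (L J \<Otimes>\<^sub>M L K) (L (J \<union> K)) (merge J K)"
    using fin disj
    by (subst pair_measure_distr)
      (auto simp: L_def distr_merge_lborel sigma_finite_PiM_lborel intro!: measurable_merge)
  also have "\<dots> = L I \<Otimes>\<^sub>M L (J \<union> K)"
    using fin disj by (simp add: L_def distr_merge_lborel)
  finally have "distr (L I \<Otimes>\<^sub>M L J \<Otimes>\<^sub>M L K) (L (I \<union> J \<union> K)) (merge I (J \<union> K) \<circ> ?g) =
      distr (L I \<Otimes>\<^sub>M L (J \<union> K)) (L (I \<union> J \<union> K)) (merge I (J \<union> K))"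
    using distr_distr[OF h g] by simp
  also have "\<dots> = L (I \<union> J \<union> K)"
    using fin disj distr_merge_lborel[of I "J \<union> K"] by (simp add: L_def Un_assoc Int_Un_distrib)
  finally show "distr (L I \<Otimes>\<^sub>M L J \<Otimes>\<^sub>M L K) (L (I \<union> J \<union> K))
      (\<lambda>(x, y, z). merge I (J \<union> K) (x, merge J K (y, z))) = L (I \<union> J \<union> K)"
    unfolding eq .
qed

lemma restrict_subvector: "J \<subseteq> I \<Longrightarrow> restrict (subvector X I \<omega>) J = subvector X J \<omega>"
  by (auto simp: subvector_def fun_eq_iff)

lemma restrict_space_PiM_lborel: "x \<in> space (Pi\<^sub>M I (\<lambda>_. lborel)) \<Longrightarrow> restrict x I = x"
  by (auto simp: space_PiM PiE_def extensional_restrict)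

context information_space
begin

text \<open>Passes from the product over \<open>I \<union> J\<close>, in which
  \<open>diff_entropy\<close> is defined, to the binary product that \<open>density_triple\<close>
  requires.\<close>

lemma has_finite_entropy_pair:
  assumes "finite I" "finite J" "I \<inter> J = {}" and "has_finite_entropy M b X (I \<union> J)"
  obtains p where "finite_entropy (Pi\<^sub>M I (\<lambda>_. lborel) \<Otimes>\<^sub>M Pi\<^sub>M J (\<lambda>_. lborel))
      (\<lambda>\<omega>. (subvector X I \<omega>, subvector X J \<omega>)) p"
    and "entropy b (Pi\<^sub>M I (\<lambda>_. lborel) \<Otimes>\<^sub>M Pi\<^sub>M J (\<lambda>_. lborel))
      (\<lambda>\<omega>. (subvector X I \<omega>, subvector X J \<omega>)) = diff_entropy M b X (I \<union> J)"
proof -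
  let ?L = "\<lambda>I. Pi\<^sub>M I (\<lambda>_. lborel)"
  obtain p where p: "finite_entropy (?L (I \<union> J)) (subvector X (I \<union> J)) p"
    using assms(4) by (auto simp: has_finite_entropy_def)
  have psi: "(\<lambda>x. (restrict x I, restrict x J)) \<in> measurable (?L (I \<union> J)) (?L I \<Otimes>\<^sub>M ?L J)"
    by (intro measurable_Pair measurable_restrict_subset) auto
  have inv: "(restrict (merge I J x) I, restrict (merge I J x) J) = x"
    if "x \<in> space (?L I \<Otimes>\<^sub>M ?L J)" for x
    using that assms(3) by (cases x) (simp add: space_pair_measure restrict_space_PiM_lborel)
  show ?thesis
    using finite_entropy_transport[where \<phi> = "merge I J" and \<psi> = "\<lambda>x. (restrict x I, restrict x J)",
        OF p measurable_merge distr_merge_lborel[OF assms(1-3)] psi inv]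
    by (intro that) (simp_all add: restrict_subvector diff_entropy_def)
qed

lemma has_finite_entropy_triple:
  assumes "finite I" "finite J" "finite K" "I \<inter> J = {}" "I \<inter> K = {}" "J \<inter> K = {}"
    and "has_finite_entropy M b X (I \<union> J \<union> K)"
  obtains p where "finite_entropy (Pi\<^sub>M I (\<lambda>_. lborel) \<Otimes>\<^sub>M Pi\<^sub>M J (\<lambda>_. lborel) \<Otimes>\<^sub>M Pi\<^sub>M K (\<lambda>_. lborel))
      (\<lambda>\<omega>. (subvector X I \<omega>, subvector X J \<omega>, subvector X K \<omega>)) p"
    and "entropy b (Pi\<^sub>M I (\<lambda>_. lborel) \<Otimes>\<^sub>M Pi\<^sub>M J (\<lambda>_. lborel) \<Otimes>\<^sub>M Pi\<^sub>M K (\<lambda>_. lborel))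
      (\<lambda>\<omega>. (subvector X I \<omega>, subvector X J \<omega>, subvector X K \<omega>)) = diff_entropy M b X (I \<union> J \<union> K)"
proof -
  let ?L = "\<lambda>I. Pi\<^sub>M I (\<lambda>_. lborel)"
  let ?phi = "\<lambda>(x, y, z). merge I (J \<union> K) (x, merge J K (y, z))"
  obtain p where p: "finite_entropy (?L (I \<union> J \<union> K)) (subvector X (I \<union> J \<union> K)) p"
    using assms(7) by (auto simp: has_finite_entropy_def)
  have psi: "(\<lambda>x. (restrict x I, restrict x J, restrict x K)) \<in>
      measurable (?L (I \<union> J \<union> K)) (?L I \<Otimes>\<^sub>M ?L J \<Otimes>\<^sub>M ?L K)"
    by (intro measurable_Pair measurable_restrict_subset) auto
  have inv: "(restrict (?phi v) I, restrict (?phi v) J, restrict (?phi v) K) = v"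
    if v: "v \<in> space (?L I \<Otimes>\<^sub>M ?L J \<Otimes>\<^sub>M ?L K)" for v
  proof -
    obtain x y z where xyz: "v = (x, y, z)"
      by (cases v)
    have "restrict (?phi v) I = restrict x I" "restrict (?phi v) J = restrict y J"
      "restrict (?phi v) K = restrict z K"
      using assms(4-6) by (auto simp: xyz merge_def fun_eq_iff)
    then show ?thesis
      using v by (simp add: xyz space_pair_measure restrict_space_PiM_lborel)
  qed
  show ?thesis
    using finite_entropy_transport[where \<phi> = ?phi and \<psi> = "\<lambda>x. (restrict x I, restrict x J, restrict x K)",
        OF p distr_merge3_lborel[OF assms(1-6)] psi inv]
    by (intro that) (simp_all add: restrict_subvector le_supI1 diff_entropy_def)
qed

lemma
  fixes X :: "'v \<Rightarrow> 'a \<Rightarrow> real"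
  assumes fin: "finite I" "finite J" "finite K"
    and disj: "I \<inter> J = {}" "I \<inter> K = {}" "J \<inter> K = {}"
    and ent: "\<And>S. S \<subseteq> I \<union> J \<union> K \<Longrightarrow> has_finite_entropy M b X S"
  defines "gap \<equiv> diff_entropy M b X (I \<union> K) + diff_entropy M b X (J \<union> K) -
    diff_entropy M b X (I \<union> J \<union> K) - diff_entropy M b X K"
  shows diff_entropy_submodular: "0 \<le> gap"
    and diff_entropy_modular_iff_cond_indep: "gap = 0 \<longleftrightarrow> cond_indep M X I J K"
proof -
  let ?L = "\<lambda>I. Pi\<^sub>M I (\<lambda>_. lborel)"
  \<comment> \<open>\<open>cond_indep\<close> uses \<open>borel\<close> and the densities use
    \<open>lborel\<close>; both have the same measurable sets.\<close>
  have borel: "generated_algebra M X S = vimage_algebra (space M) (subvector X S) (?L S)" for S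
    unfolding generated_algebra_def by (intro vimage_algebra_cong sets_PiM_cong) auto
  obtain pz where pz: "finite_entropy (?L K) (subvector X K) pz"
    using ent[of K] by (auto simp: has_finite_entropy_def)
  obtain pxz where pxz: "finite_entropy (?L I \<Otimes>\<^sub>M ?L K) (\<lambda>\<omega>. (subvector X I \<omega>, subvector X K \<omega>)) pxz"
    "entropy b (?L I \<Otimes>\<^sub>M ?L K) (\<lambda>\<omega>. (subvector X I \<omega>, subvector X K \<omega>)) = diff_entropy M b X (I \<union> K)"
    using has_finite_entropy_pair[OF fin(1,3) disj(2) ent[of "I \<union> K"]] by auto
  obtain pyz where pyz: "finite_entropy (?L J \<Otimes>\<^sub>M ?L K) (\<lambda>\<omega>. (subvector X J \<omega>, subvector X K \<omega>)) pyz"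
    "entropy b (?L J \<Otimes>\<^sub>M ?L K) (\<lambda>\<omega>. (subvector X J \<omega>, subvector X K \<omega>)) = diff_entropy M b X (J \<union> K)"
    using has_finite_entropy_pair[OF fin(2,3) disj(3) ent[of "J \<union> K"]] by auto
  obtain pxyz where pxyz: "finite_entropy (?L I \<Otimes>\<^sub>M ?L J \<Otimes>\<^sub>M ?L K)
      (\<lambda>\<omega>. (subvector X I \<omega>, subvector X J \<omega>, subvector X K \<omega>)) pxyz"
    "entropy b (?L I \<Otimes>\<^sub>M ?L J \<Otimes>\<^sub>M ?L K) (\<lambda>\<omega>. (subvector X I \<omega>, subvector X J \<omega>, subvector X K \<omega>)) =
      diff_entropy M b X (I \<union> J \<union> K)"
    using has_finite_entropy_triple[OF fin disj ent] by auto
  interpret density_triple M b "?L I" "?L J" "?L K" "subvector X I" "subvector X J" "subvector X K"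
    pz pxz pyz pxyz
    using fin pz pxz(1) pyz(1) pxyz(1)
    by (intro density_triple.intro density_triple_axioms.intro sigma_finite_PiM_lborel
        information_space_axioms)
  have gap: "gap = entropy_gap"
    by (simp add: gap_def entropy_gap_def pxz(2) pyz(2) pxyz(2) diff_entropy_def)
  show "0 \<le> gap"
    unfolding gap by (rule entropy_gap_nonneg)
  show "gap = 0 \<longleftrightarrow> cond_indep M X I J K"
    unfolding gap entropy_gap_eq_0_iff distr_eq_q_iff_cond_indep cond_indep_def borel ..
qed

text \<open>Submodularity for the blocks \<open>{T}\<close>, \<open>R - S\<close> and
  \<open>S\<close>: there \<open>gap\<close> is the drop of the conditional entropy of
  \<open>T\<close> from \<open>S\<close> to \<open>R\<close>.\<close>

lemma
  fixes X :: "'v \<Rightarrow> 'a \<Rightarrow> real"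
  assumes fin: "finite R" and sub: "S \<subseteq> R" "T \<notin> R"
    and ent: "\<And>S. S \<subseteq> insert T R \<Longrightarrow> has_finite_entropy M b X S"
  shows cond_diff_entropy_antimono: "cond_diff_entropy M b X T R \<le> cond_diff_entropy M b X T S"
    and cond_diff_entropy_eq_iff_cond_indep:
      "cond_diff_entropy M b X T R = cond_diff_entropy M b X T S \<longleftrightarrow> cond_indep M X {T} (R - S) S"
proof -
  have sets: "{T} \<union> S = insert T S" "R - S \<union> S = R" "{T} \<union> (R - S) \<union> S = insert T R"
    using sub by auto
  have facts: "finite {T}" "finite (R - S)" "finite S"
    "{T} \<inter> (R - S) = {}" "{T} \<inter> S = {}" "(R - S) \<inter> S = {}"
    "\<And>U. U \<subseteq> {T} \<union> (R - S) \<union> S \<Longrightarrow> has_finite_entropy M b X U"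
    using sub fin finite_subset[of S R] ent by (auto simp only: sets)
  show "cond_diff_entropy M b X T R \<le> cond_diff_entropy M b X T S"
    using diff_entropy_submodular[OF facts] unfolding sets by (simp add: cond_diff_entropy_def)
  show "cond_diff_entropy M b X T R = cond_diff_entropy M b X T S \<longleftrightarrow> cond_indep M X {T} (R - S) S"
    using diff_entropy_modular_iff_cond_indep[OF facts] unfolding sets
    by (auto simp: cond_diff_entropy_def)
qed

end

section \<open>Minimizers of the conditional entropy\<close>

theorem theorem2:
  fixes M :: "'a measure" and b :: real
    and X :: "'v \<Rightarrow> 'a \<Rightarrow> real" and V :: "'v set" and E :: "('v \<times> 'v) set" and T :: 'v
    and p :: "('v \<Rightarrow> real) \<Rightarrow> ennreal"
  assumes "information_space M b"
    and "dag V E"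
    and "distributed M (Pi\<^sub>M V (\<lambda>_. lborel)) (subvector X V) p"
    and "\<And>S. S \<subseteq> V \<Longrightarrow> has_finite_entropy M b X S"
    and "faithful M X V E"
    and "T \<in> V"
  shows "(\<forall>S. is_arg_min (cond_diff_entropy M b X T) (\<lambda>S. S \<subseteq> V - {T}) S \<and>
              (\<forall>S'. is_arg_min (cond_diff_entropy M b X T) (\<lambda>S. S \<subseteq> V - {T}) S' \<longrightarrow> \<not> S' \<subset> S)
            \<longleftrightarrow> S = markov_boundary E T) \<and>
         (\<forall>S'. S' \<subseteq> V - {T} \<and> markov_boundary E T \<subseteq> S' \<longrightarrow>
            cond_diff_entropy M b X T S' = cond_diff_entropy M b X T (markov_boundary E T))"
proof -
  interpret information_space M b by fact
  let ?h = "cond_diff_entropy M b X T" and ?B = "markov_boundary E T" and ?U = "V - {T}"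
  have BU: "?B \<subseteq> ?U"
    by (rule markov_boundary_subset[OF assms(2)])
  have fin: "finite R" if "R \<subseteq> ?U" for R
    using assms(2) that by (auto simp: dag_def intro: finite_subset)
  have ent: "has_finite_entropy M b X S" if "S \<subseteq> insert T R" "R \<subseteq> ?U" for R S
    using that assms(6) by (intro assms(4)) auto
  have anti: "?h R \<le> ?h S" if "R \<subseteq> ?U" "S \<subseteq> R" for R S
    using that assms(6) by (intro cond_diff_entropy_antimono fin ent) auto
  have eq_iff: "?h R = ?h S \<longleftrightarrow> d_separated E {T} (R - S) S" if "R \<subseteq> ?U" "S \<subseteq> R" for R S
  proof -
    have "?h R = ?h S \<longleftrightarrow> cond_indep M X {T} (R - S) S"
      using that assms(6) by (intro cond_diff_entropy_eq_iff_cond_indep fin ent) auto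
    also have "\<dots> \<longleftrightarrow> d_separated E {T} (R - S) S"
      using assms(5)[unfolded faithful_def, rule_format, of "{T}" "R - S" S] that assms(6) by auto
    finally show ?thesis .
  qed
  have super: "?h R = ?h ?B" if "R \<subseteq> ?U" "?B \<subseteq> R" for R
    using that by (subst eq_iff) (auto intro!: markov_boundary_d_separated[OF assms(2)])
  \<comment> \<open>The minimizers are the sets between \<open>?B\<close> and \<open>?U\<close>.
    This family has \<open>?B\<close> as least element, hence as its only minimal one.\<close>
  have min_iff: "is_arg_min ?h (\<lambda>S. S \<subseteq> ?U) S \<longleftrightarrow> S \<subseteq> ?U \<and> ?B \<subseteq> S" for S
  proof
    assume S: "is_arg_min ?h (\<lambda>S. S \<subseteq> ?U) S"
    \<comment> \<open>By monotonicity the full set \<open>?U\<close> attains the minimum, so every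
      minimizer shares its value.\<close>
    then have "S \<subseteq> ?U" "?h ?U = ?h S"
      using anti[of ?U S] by (auto simp: is_arg_min_linorder)
    then have "d_separated E {T} (?U - S) S"
      by (subst eq_iff[symmetric]) auto
    then show "S \<subseteq> ?U \<and> ?B \<subseteq> S"
      using d_separator_contains_markov_boundary[OF assms(2), of T S] \<open>S \<subseteq> ?U\<close> by auto
  next
    assume S: "S \<subseteq> ?U \<and> ?B \<subseteq> S"
    have "?h S \<le> ?h R" if "R \<subseteq> ?U" for R
      using super[of S] super[of ?U] BU S anti[of ?U R] that by auto
    with S show "is_arg_min ?h (\<lambda>S. S \<subseteq> ?U) S"
      by (simp add: is_arg_min_linorder)
  qed
  show ?thesis
    unfolding min_iff using BU super by blast
qed

end
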